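(* For $k\in\mathbb{N}_0$ and $a>0$, \[ \int_0^\infty \frac{(x^k-1)\ln x\,dx}{(x-1)(x+a)^{k+1}} = \frac{1}{(a+1)^{k+1}}\sum_{j=0}^{k-1}\frac{(1+1/a)^{j+1}}{j+1}\left((a^{j+1}-1)H_j + (a^{j+1}+1)\ln a\right), \] and \[ \int_0^\infty \frac{(x^k+1)\ln x\,dx}{(x-1)(x+a)^{k+1}} = \frac{\pi^2+\ln^2 a}{(a+1)^{k+1}} + \frac{1}{(a+1)^{k+1}}\sum_{j=0}^{k-1}\frac{(1+1/a)^{j+1}}{j+1}\left((a^{j+1}+1)H_j + (a^{j+1}-1)\ln a\right). \]
   Context: $H_n=\sum_{i=1}^n \frac1i$ denotes the $n$-th harmonic number, with $H_0=0$. Empty sums are zero. *)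

theory Defs
  imports "HOL-Analysis.Analysis"
begin

end

theory Submission
  imports Defs "HOL-Real_Asymp.Real_Asymp"
begin

text \<open>
  Both identities are the difference and the sum of the evaluations of
  \<open>A k = \<integral> x^k ln x / ((x - 1) (x + a)^(k + 1))\<close> and
  \<open>B k = \<integral> ln x / ((x - 1) (x + a)^(k + 1))\<close> over the positive half-line. Partial fractions give
  \<open>(a + 1) A (k + 1) = A k + a \<integral> x^k ln x / (x + a)^(k + 2)\<close> and
  \<open>(a + 1) B (k + 1) = B k - \<integral> ln x / (x + a)^(k + 2)\<close>. The two pole-free integrals satisfy
  first-order recurrences by integration by parts, which is where the harmonic numbers come from.
  The common initial value \<open>A 0 = B 0\<close> splits into \<open>\<integral> 2 ln x / (x^2 - 1) = pi^2 / 2\<close>,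
  a geometric series summing the inverse odd squares, and
  \<open>\<integral> ln x (1 / (x + 1) - 1 / (x + a)) = (ln a)^2 / 2\<close>, which follows from
  the reflection formula \<open>K x + K (1 / x) = (ln x)^2 / 2 + const\<close> for an antiderivative \<open>K\<close> of
  \<open>ln x / (1 + x)\<close>.
\<close>

subsection \<open>Improper integrals over the positive half-line\<close>

text \<open>The fundamental theorem for interval integrals states its endpoint limits over the
  extended reals; this carries a real one-sided limit at 0 into that form.\<close>

lemma at_right_zero_ereal:
  assumes "(F \<longlongrightarrow> A) (at_right (0::real))"
  shows "((F \<circ> real_of_ereal) \<longlongrightarrow> A) (at_right (0::ereal))"
  using assms unfolding ereal_tendsto_simps1 zero_ereal_def by simp

lemma set_integrable_absolutely_on:
  fixes f :: "real \<Rightarrow> real"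
  assumes "set_integrable lborel S f"
  shows "f absolutely_integrable_on S"
  using assms unfolding set_integrable_def
  by (subst integrable_completion) (auto dest: borel_measurable_integrable)

text \<open>For a nonnegative integrand, finite limits of an antiderivative at both ends already
  force integrability, so one argument yields both the convergence and the value.\<close>

lemma FTC_Ioi_nonneg:
  fixes f F :: "real \<Rightarrow> real"
  assumes F: "\<And>x. x > 0 \<Longrightarrow> (F has_real_derivative f x) (at x)"
    and f: "continuous_on {0<..} f" and nn: "\<And>x. x > 0 \<Longrightarrow> f x \<ge> 0"
    and A: "(F \<longlongrightarrow> A) (at_right 0)" and B: "(F \<longlongrightarrow> B) at_top"
  shows "f absolutely_integrable_on {0<..}" "(f has_integral (B - A)) {0<..}"
proof -
  have cont: "isCont f x" if "x > 0" for x
    using f that by (simp add: continuous_on_eq_continuous_at)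
  have ei: "einterval 0 \<infinity> = {0<..}"
    by (auto simp: einterval_def)
  note FTC = interval_integral_FTC_nonneg[of 0 \<infinity> F f A B]
  have i: "set_integrable lborel {0<..} f"
    unfolding ei[symmetric]
    by (rule FTC(1)) (use F cont nn A B in \<open>auto intro: at_right_zero_ereal simp: ereal_tendsto_simps1\<close>)
  have v: "(LBINT x=0..\<infinity>. f x) = B - A"
    by (rule FTC(2)) (use F cont nn A B in \<open>auto intro: at_right_zero_ereal simp: ereal_tendsto_simps1\<close>)
  show "f absolutely_integrable_on {0<..}"
    using i by (rule set_integrable_absolutely_on)
  show "(f has_integral (B - A)) {0<..}"
    using v has_integral_integral[THEN iffD1, OF set_borel_integral_eq_integral(1)[OF i]]
    by (simp add: interval_lebesgue_integral_def ei set_borel_integral_eq_integral(2)[OF i])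
qed

text \<open>For integrands that change sign, as those with \<open>ln x\<close> do at 1. Endpoint
  limits alone would give only conditional convergence, so absolute integrability enters as a
  hypothesis and is later supplied by domination.\<close>

lemma FTC_Ioi:
  fixes f F :: "real \<Rightarrow> real"
  assumes F: "\<And>x. x > 0 \<Longrightarrow> (F has_real_derivative f x) (at x)"
    and f: "continuous_on {0<..} f" and i: "f absolutely_integrable_on {0<..}"
    and A: "(F \<longlongrightarrow> A) (at_right 0)" and B: "(F \<longlongrightarrow> B) at_top"
  shows "(f has_integral (B - A)) {0<..}"
proof -
  have cont: "isCont f x" if "x > 0" for x
    using f that by (simp add: continuous_on_eq_continuous_at)
  have ei: "einterval 0 \<infinity> = {0<..}"
    by (auto simp: einterval_def)
  \<comment> \<open>Passing from the completed measure back to \<open>lborel\<close> requires Borel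
    measurability, which continuity provides.\<close>
  have i': "set_integrable lborel {0<..} f"
    using i f unfolding set_integrable_def
    by (subst (asm) integrable_completion) (use borel_measurable_continuous_on_indicator[OF _ f] in auto)
  have v: "(LBINT x=0..\<infinity>. f x) = B - A"
    by (rule interval_integral_FTC_integrable[of 0 \<infinity> F f A B]) 
      (use F cont i' A B in \<open>auto intro: at_right_zero_ereal simp: ereal_tendsto_simps1 ei
        simp flip: has_real_derivative_iff_has_vector_derivative\<close>)
  show "(f has_integral (B - A)) {0<..}"
    using v has_integral_integral[THEN iffD1, OF set_borel_integral_eq_integral(1)[OF i']]
    by (simp add: interval_lebesgue_integral_def ei set_borel_integral_eq_integral(2)[OF i'])
qed

lemma FTC_Ioo_nonneg:
  fixes f F :: "real \<Rightarrow> real"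
  assumes F: "\<And>x. 0 < x \<Longrightarrow> x < 1 \<Longrightarrow> (F has_real_derivative f x) (at x)"
    and f: "continuous_on {0<..<1} f" and nn: "\<And>x. 0 < x \<Longrightarrow> x < 1 \<Longrightarrow> f x \<ge> 0"
    and A: "(F \<longlongrightarrow> A) (at_right 0)" and B: "(F \<longlongrightarrow> B) (at_left 1)"
  shows "(f has_integral (B - A)) {0<..<1}"
proof -
  have cont: "isCont f x" if "0 < x" "x < 1" for x
    using f that by (simp add: continuous_on_eq_continuous_at)
  have ei: "einterval 0 1 = {0<..<1}"
    by (auto simp: einterval_def)
  have B': "((F \<circ> real_of_ereal) \<longlongrightarrow> B) (at_left 1)"
    using B unfolding one_ereal_def by (simp add: ereal_tendsto_simps1)
  note FTC = interval_integral_FTC_nonneg[of 0 1 F f A B]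
  have i: "set_integrable lborel {0<..<1} f"
    unfolding ei[symmetric]
    by (rule FTC(1)) (use F cont nn A B' in \<open>auto intro: at_right_zero_ereal\<close>)
  have v: "(LBINT x=0..1. f x) = B - A"
    by (rule FTC(2)) (use F cont nn A B' in \<open>auto intro: at_right_zero_ereal\<close>)
  show ?thesis
    using v has_integral_integral[THEN iffD1, OF set_borel_integral_eq_integral(1)[OF i]]
    by (simp add: interval_lebesgue_integral_def ei set_borel_integral_eq_integral(2)[OF i])
qed

section \<open>Domination of logarithmic integrands\<close>

lemma abs_ln_le:
  fixes x :: real
  assumes "x > 0"
  shows "\<bar>ln x\<bar> \<le> 2 * (1 + x) / sqrt x"
proof -
  have s: "sqrt x > 0" using assms by simp
  \<comment> \<open>The bound \<open>ln t <= t - 1\<close> is used at \<open>sqrt x\<close> and at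
    its reciprocal: this costs only a square root at each end of the half-line, where
    \<open>t = x\<close> would cost a full power.\<close>
  have 1: "ln (sqrt x) \<le> sqrt x - 1" "ln (1 / sqrt x) \<le> 1 / sqrt x - 1"
    using s by (intro ln_le_minus_one; simp)+
  have 2: "ln (sqrt x) = ln x / 2" "ln (1 / sqrt x) = - ln x / 2"
    using assms by (auto simp: ln_sqrt ln_div)
  have "2 * (1 + x) / sqrt x = 2 * (1 / sqrt x) + 2 * sqrt x"
    using s assms by (simp add: field_simps)
  moreover have "1 / sqrt x > 0" using s by simp
  ultimately show ?thesis using 1 2 s by linarith
qed

text \<open>The common majorant for the logarithmic integrands, integrable because it is positive
  and has the bounded antiderivative \<open>2 * arctan (sqrt x)\<close>.\<close>

lemma integrable_inverse_sqrt:
  "(\<lambda>x. 1 / (sqrt x * (1 + x))) absolutely_integrable_on {0<..}"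
proof (rule FTC_Ioi_nonneg(1))
  fix x :: real assume x: "x > 0"
  show "((\<lambda>x. 2 * arctan (sqrt x)) has_real_derivative 1 / (sqrt x * (1 + x))) (at x)"
    using x by (auto intro!: derivative_eq_intros simp: divide_simps)
  show "1 / (sqrt x * (1 + x)) \<ge> 0" using x by simp
next
  show "continuous_on {0<..} (\<lambda>x::real. 1 / (sqrt x * (1 + x)))"
    by (intro continuous_intros) auto
  show "((\<lambda>x. 2 * arctan (sqrt x)) \<longlongrightarrow> 0) (at_right 0)" 
    by real_asymp
  show "((\<lambda>x. 2 * arctan (sqrt x)) \<longlongrightarrow> pi) at_top"
    by real_asymp
qed

lemma ln_dominated_absolutely_integrable:
  fixes f :: "real \<Rightarrow> real"
  assumes f: "continuous_on {0<..} f"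
    and le: "\<And>x. x > 0 \<Longrightarrow> \<bar>f x\<bar> \<le> C * \<bar>ln x\<bar> / (x + a)\<^sup>2"
    and a: "a > 0" and "C \<ge> 0"
  shows "f absolutely_integrable_on {0<..}"
proof -
  \<comment> \<open>Chosen so that \<open>1 + x <= c * (x + a)\<close>, which replaces the shift
    \<open>a\<close> by 1. One factor \<open>1 + x\<close> then cancels against the bound on the
    logarithm and leaves a multiple of the majorant.\<close>
  define c where "c = max 1 (1 / a)"
  have c: "c \<ge> 1" "c * a \<ge> 1" using a by (auto simp: c_def max_def field_simps)
  have "f \<in> borel_measurable (lebesgue_on {0<..})"
    by (intro continuous_imp_measurable_on_sets_lebesgue f) auto
  moreover have "(\<lambda>x. 2 * C * c\<^sup>2 * (1 / (sqrt x * (1 + x)))) integrable_on {0<..}"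
    using integrable_inverse_sqrt by (intro integrable_on_mult_right) (auto simp: absolutely_integrable_on_def)
  moreover have "norm (f x) \<le> 2 * C * c\<^sup>2 * (1 / (sqrt x * (1 + x)))" if "x \<in> {0<..}" for x
  proof -
    have x: "x > 0" using that by simp
    have "1 * x \<le> c * x" using c x by (intro mult_right_mono) auto
    then have "1 + x \<le> c * (x + a)" using c by (simp add: algebra_simps)
    then have "(1 + x)\<^sup>2 \<le> (c * (x + a))\<^sup>2" using x by (intro power_mono) auto
    then have "1 / (x + a)\<^sup>2 \<le> c\<^sup>2 / (1 + x)\<^sup>2"
      using x a by (simp add: divide_simps power_mult_distrib mult.commute)
    then have "C * \<bar>ln x\<bar> * (1 / (x + a)\<^sup>2) \<le> C * (2 * (1 + x) / sqrt x) * (c\<^sup>2 / (1 + x)\<^sup>2)"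
      using \<open>C \<ge> 0\<close> x by (intro mult_mono abs_ln_le) auto
    also have "\<dots> = 2 * C * c\<^sup>2 * (1 / (sqrt x * (1 + x)))"
      using x by (simp add: divide_simps power2_eq_square)
    finally show ?thesis using le[OF x] by simp
  qed
  ultimately show ?thesis
    by (intro measurable_bounded_by_integrable_imp_absolutely_integrable
        [of f "{0<..}" "\<lambda>x. 2 * C * c\<^sup>2 * (1 / (sqrt x * (1 + x)))"]) auto
qed

subsection \<open>The inverse odd squares\<close>

text \<open>Group the series of all inverse squares into consecutive pairs. The even member of each
  pair is a quarter of a term of the original series, so removing it leaves three quarters of
  pi^2/6.\<close>

lemma odd_squares_sums: "(\<lambda>n. 1 / (real (2 * n + 1))\<^sup>2) sums (pi\<^sup>2 / 8)"
proof -
  have "(\<lambda>n. sum (\<lambda>n. 1 / (real (n + 1))\<^sup>2) {n * 2..<n * 2 + 2}) sums (pi\<^sup>2 / 6)"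
    using inverse_squares_sums by (intro sums_group) (simp_all add: add.commute)
  moreover have "(\<lambda>n. 1 / 4 * (1 / (real (n + 1))\<^sup>2)) sums (1 / 4 * (pi\<^sup>2 / 6))"
    using inverse_squares_sums by (intro sums_mult) (simp add: add.commute)
  ultimately have "(\<lambda>n. sum (\<lambda>n. 1 / (real (n + 1))\<^sup>2) {n * 2..<n * 2 + 2}
        - 1 / 4 * (1 / (real (n + 1))\<^sup>2)) sums (pi\<^sup>2 / 6 - 1 / 4 * (pi\<^sup>2 / 6))"
    by (rule sums_diff)
  moreover have "sum (\<lambda>n. 1 / (real (n + 1))\<^sup>2) {n * 2..<n * 2 + 2}
        - 1 / 4 * (1 / (real (n + 1))\<^sup>2)
      = 1 / (real (2 * n + 1))\<^sup>2" for n
  proof -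
    have "{n * 2..<n * 2 + 2} = {n * 2, n * 2 + 1}" by auto
    moreover have "(real (n * 2 + 1) + 1)\<^sup>2 = 4 * (real (n + 1))\<^sup>2"
      by (simp add: power2_eq_square algebra_simps)
    ultimately show ?thesis by (simp add: algebra_simps)
  qed
  ultimately show ?thesis by simp
qed

section \<open>The integral of ln x / (x^2 - 1)\<close>

lemma has_integral_power_ln:
  "((\<lambda>x::real. - (x ^ m * ln x)) has_integral 1 / (real (m + 1))\<^sup>2) {0<..<1}"
proof -
  \<comment> \<open>The factor \<open>x * ln x\<close> is kept together because it tends to 0 at 0;
    this settles the boundary limit for all \<open>m\<close>, including 0.\<close>
  define F where "F = (\<lambda>x::real. x ^ m * x / (real m + 1)\<^sup>2 - x ^ m * (x * ln x) / (real m + 1))"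
  have "((\<lambda>x::real. - (x ^ m * ln x)) has_integral 1 / (real m + 1)\<^sup>2 - 0) {0<..<1}"
  proof (rule FTC_Ioo_nonneg)
    fix x :: real assume x: "0 < x" "x < 1"
    have F': "F = (\<lambda>x. x ^ Suc m / (real m + 1)\<^sup>2 - x ^ Suc m * ln x / (real m + 1))"
      by (simp add: F_def mult_ac)
    show "(F has_real_derivative - (x ^ m * ln x)) (at x)"
      unfolding F' using x
      by (auto intro!: derivative_eq_intros simp del: power_Suc)
         (simp add: divide_simps power2_eq_square, simp add: algebra_simps power4_eq_xxxx)
    show "0 \<le> - (x ^ m * ln x)"
      using x by (simp add: mult_nonneg_nonpos)
  next
    show "continuous_on {0<..<1} (\<lambda>x::real. - (x ^ m * ln x))"
      by (intro continuous_intros) auto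
    have "((\<lambda>x::real. x * ln x) \<longlongrightarrow> 0) (at_right 0)" by real_asymp
    then have "(F \<longlongrightarrow> 0 ^ m * 0 / (real m + 1)\<^sup>2 - 0 ^ m * 0 / (real m + 1)) (at_right 0)"
      unfolding F_def by (intro tendsto_intros) auto
    then show "(F \<longlongrightarrow> 0) (at_right 0)" by simp
    have "(F \<longlongrightarrow> 1 ^ m * 1 / (real m + 1)\<^sup>2 - 1 ^ m * (1 * ln 1) / (real m + 1)) (at_left 1)"
      unfolding F_def by (intro tendsto_intros) auto
    then show "(F \<longlongrightarrow> 1 / (real m + 1)\<^sup>2) (at_left 1)" by simp
  qed
  then show ?thesis by (simp add: add.commute)
qed

text \<open>Expand 1 / (1 - x^2) as a geometric series. Since \<open>- ln x\<close> is positive on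
  the unit interval, the partial sums increase and monotone convergence allows termwise integration,
  producing the inverse odd squares.\<close>

lemma has_integral_ln_over_square_Ioo:
  "((\<lambda>x::real. ln x / (x\<^sup>2 - 1)) has_integral pi\<^sup>2 / 8) {0<..<1}"
proof (rule has_integral_monotone_convergence_increasing)
  show "((\<lambda>x::real. \<Sum>i<k. - (x ^ (2 * i) * ln x)) has_integral
      (\<Sum>i<k. 1 / (real (2 * i + 1))\<^sup>2)) {0<..<1}" for k
    by (intro has_integral_sum has_integral_power_ln) auto
  show "(\<lambda>k. \<Sum>i<k. 1 / (real (2 * i + 1))\<^sup>2) \<longlonglongrightarrow> pi\<^sup>2 / 8"
    using odd_squares_sums by (simp add: sums_def)
  fix x :: real assume x: "x \<in> {0<..<1}"
  show "(\<Sum>i<k. - (x ^ (2 * i) * ln x)) \<le> (\<Sum>i<Suc k. - (x ^ (2 * i) * ln x))" for k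
    using x by (simp add: mult_nonneg_nonpos)
  have "x\<^sup>2 < 1" using x by (simp add: power_less_one_iff)
  then have "(\<lambda>i. - ln x * (x\<^sup>2) ^ i) sums (- ln x * (1 / (1 - x\<^sup>2)))"
    by (intro sums_mult geometric_sums) auto
  moreover have "- ln x * (1 / (1 - x\<^sup>2)) = ln x / (x\<^sup>2 - 1)"
    using \<open>x\<^sup>2 < 1\<close> by (simp add: divide_simps) (simp add: algebra_simps)
  ultimately show "(\<lambda>k. \<Sum>i<k. - (x ^ (2 * i) * ln x)) \<longlonglongrightarrow> ln x / (x\<^sup>2 - 1)"
    by (simp only: sums_def power_mult mult_minus_left mult.commute[of _ "ln x"])
qed

lemma has_integral_ln_over_square:
  "((\<lambda>x::real. ln x / (x\<^sup>2 - 1)) has_integral pi\<^sup>2 / 4) {0<..}"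
proof -
  define f :: "real \<Rightarrow> real" where "f = (\<lambda>x. ln x / (x\<^sup>2 - 1))"
  have f01: "(f has_integral pi\<^sup>2 / 8) {0<..<1}"
    unfolding f_def by (rule has_integral_ln_over_square_Ioo)
  \<comment> \<open>The integrand is invariant under x -> 1/x once the Jacobian is included, so the
    part beyond 1 contributes exactly as much as the part below 1.\<close>
  have inv: "\<bar>- (1 / x\<^sup>2)\<bar> * f (1 / x) = f x" if "x \<in> {0<..<1}" for x
  proof -
    have "x\<^sup>2 < 1" "x > 0" using that by (auto simp: power_less_one_iff)
    then have "x\<^sup>2 - 1 \<noteq> 0" "1 - x\<^sup>2 \<noteq> 0" "x \<noteq> 0" by auto
    then show ?thesis
      using \<open>x > 0\<close> unfolding f_def by (simp add: ln_div divide_simps) (simp add: algebra_simps)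
  qed
  have "f absolutely_integrable_on {0<..<1}"
  proof (rule nonnegative_absolutely_integrable_1)
    fix x :: real assume "x \<in> {0<..<1}"
    then have "x\<^sup>2 < 1" "ln x < 0" by (auto simp: power_less_one_iff)
    then show "f x \<ge> 0" by (auto simp: f_def intro!: divide_nonpos_neg)
  qed (use f01 in blast)
  then have "(\<lambda>x. \<bar>- (1 / x\<^sup>2)\<bar> * f (1 / x)) absolutely_integrable_on {0<..<1}"
    by (rule set_integrable_cong[THEN iffD1, rotated -1]) (simp_all only: inv)
  moreover have "integral {0<..<1} (\<lambda>x. \<bar>- (1 / x\<^sup>2)\<bar> * f (1 / x)) = pi\<^sup>2 / 8"
    by (rule trans[OF Henstock_Kurzweil_Integration.integral_cong[OF inv] integral_unique[OF f01]])
  moreover have "((\<lambda>x. 1 / x) has_real_derivative - (1 / x\<^sup>2)) (at x within {0<..<1})"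
    if "x \<in> {0<..<1}" for x :: real
    using that by (auto intro!: derivative_eq_intros simp: power2_eq_square)
  moreover have "inj_on (\<lambda>x::real. 1 / x) {0<..<1}"
    by (auto intro: inj_onI)
  ultimately have "f absolutely_integrable_on ((\<lambda>x. 1 / x) ` {0<..<1}) \<and>
      integral ((\<lambda>x. 1 / x) ` {0<..<1}) f = pi\<^sup>2 / 8"
    by (intro has_absolute_integral_change_of_variables_1'[THEN iffD1] conjI) auto
  moreover have "(\<lambda>x::real. 1 / x) ` {0<..<1} = {1<..}"
  proof (intro equalityI subsetI)
    fix y :: real assume "y \<in> {1<..}"
    then have "1 / y \<in> {0<..<1}" "y = 1 / (1 / y)" by auto
    then show "y \<in> (\<lambda>x. 1 / x) ` {0<..<1}" by blast
  qed auto
  ultimately have "(f has_integral pi\<^sup>2 / 8) {1<..}"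
    using set_lebesgue_integral_eq_integral(1) by (auto simp: has_integral_iff)
  moreover have "{0<..<1} \<inter> {1<..} = ({} :: real set)" by auto
  ultimately have "(f has_integral pi\<^sup>2 / 8 + pi\<^sup>2 / 8) ({0<..<1} \<union> {1<..})"
    using f01 by (intro has_integral_Un) simp_all
  moreover have "{0<..<1} \<union> {1<..} = {0<..} - {1::real}" by auto
  ultimately have "(f has_integral pi\<^sup>2 / 4) ({0<..} - {1})" by simp
  \<comment> \<open>The point 1 lies in neither piece; it is restored as a negligible set.\<close>
  then have "(f has_integral pi\<^sup>2 / 4) {0<..}"
    by (rule has_integral_spike_set_eq[THEN iffD1, rotated -1])
       (auto intro: negligible_subset[OF negligible_sing[of 1]])
  then show ?thesis by (simp add: f_def)
qed

subsection \<open>The reflection formula\<close>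

text \<open>By the mean value inequality the increment is at most
  \<open>\<bar>x - c * x\<bar>\<close> times a bound on the derivative between the two points. That
  bound grows only like \<open>\<bar>ln x\<bar>\<close>, and x ln x tends to 0. Working with
  increments avoids computing a limit of \<open>K\<close> itself.\<close>

lemma scaled_increment_tendsto_0:
  fixes K :: "real \<Rightarrow> real"
  assumes K: "\<And>x. x > 0 \<Longrightarrow> (K has_real_derivative ln x / (1 + x)) (at x)" and c: "c > 0"
  shows "((\<lambda>x. K x - K (c * x)) \<longlongrightarrow> 0) (at_right 0)"
proof (rule Lim_null_comparison)
  show "\<forall>\<^sub>F x in at_right 0. norm (K x - K (c * x)) \<le> (\<bar>ln x\<bar> + \<bar>ln c\<bar>) * \<bar>x - c * x\<bar>"
    unfolding eventually_at_right_field
  proof (intro exI[of _ 1] conjI allI impI)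
    fix x :: real assume x: "0 < x" "x < 1"
    \<comment> \<open>The ratio \<open>c\<close> may lie on either side of 1, hence
      \<open>min\<close> and \<open>max\<close>. On the segment, \<open>ln y\<close> lies between
      \<open>ln x\<close> and \<open>ln x + ln c\<close>.\<close>
    have seg: "min x (c * x) \<le> y \<and> y \<le> max x (c * x)" if "y \<in> closed_segment x (c * x)" for y
      using that by (auto simp: closed_segment_eq_real_ivl split: if_splits)
    have pos: "y > 0" if "y \<in> closed_segment x (c * x)" for y
      using seg[OF that] x mult_pos_pos[OF c x(1)] by linarith
    have bnd: "norm (ln y / (1 + y)) \<le> \<bar>ln x\<bar> + \<bar>ln c\<bar>" if "y \<in> closed_segment x (c * x)" for y
    proof -
      have y: "y > 0" using pos that by blast
      have cx: "ln (c * x) = ln c + ln x" using x c by (simp add: ln_mult)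
      have "ln y \<le> max (ln x) (ln (c * x))"
        using seg[OF that] y x c by (auto simp: max_def split: if_splits)
      moreover have "min (ln x) (ln (c * x)) \<le> ln y"
        using seg[OF that] y x c by (auto simp: min_def split: if_splits)
      ultimately have "\<bar>ln y\<bar> \<le> \<bar>ln x\<bar> + \<bar>ln c\<bar>"
        unfolding cx by linarith
      moreover have "\<bar>ln y\<bar> / (1 + y) \<le> \<bar>ln y\<bar> / 1"
        using y by (intro divide_left_mono) auto
      ultimately show ?thesis using y by simp
    qed
    show "norm (K x - K (c * x)) \<le> (\<bar>ln x\<bar> + \<bar>ln c\<bar>) * \<bar>x - c * x\<bar>"
      unfolding real_norm_def[symmetric, of "x - c * x"]
      by (rule field_differentiable_bound[of "closed_segment x (c * x)" K "\<lambda>y. ln y / (1 + y)"])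
         (use K pos bnd in \<open>auto intro: has_field_derivative_at_within\<close>)
  qed auto
  have "((\<lambda>x::real. x * ln x) \<longlongrightarrow> 0) (at_right 0)" by real_asymp
  then have "((\<lambda>x::real. \<bar>1 - c\<bar> * (\<bar>x * ln x\<bar> + \<bar>ln c\<bar> * \<bar>x\<bar>)) \<longlongrightarrow>
      \<bar>1 - c\<bar> * (\<bar>0\<bar> + \<bar>ln c\<bar> * \<bar>0\<bar>)) (at_right 0)"
    by (intro tendsto_intros)
  moreover have "(\<bar>ln x\<bar> + \<bar>ln c\<bar>) * \<bar>x - c * x\<bar>
      = \<bar>1 - c\<bar> * (\<bar>x * ln x\<bar> + \<bar>ln c\<bar> * \<bar>x\<bar>)" for x :: real
  proof -
    have "\<bar>x - c * x\<bar> = \<bar>1 - c\<bar> * \<bar>x\<bar>" by (simp add: algebra_simps flip: abs_mult)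
    then show ?thesis by (simp add: abs_mult algebra_simps)
  qed
  ultimately show "((\<lambda>x. (\<bar>ln x\<bar> + \<bar>ln c\<bar>) * \<bar>x - c * x\<bar>) \<longlongrightarrow> 0) (at_right 0)"
    by simp
qed

lemma has_integral_ln_shift_difference:
  fixes a :: real
  assumes a: "a > 0"
  shows "((\<lambda>x. ln x * (1 / (x + 1) - 1 / (x + a))) has_integral (ln a)\<^sup>2 / 2) {0<..}"
proof -
  \<comment> \<open>A closed form would involve the dilogarithm; any antiderivative will do, since
    the argument uses its derivative only.\<close>
  obtain K :: "real \<Rightarrow> real" where K: "\<And>x. x > 0 \<Longrightarrow> (K has_real_derivative ln x / (1 + x)) (at x)"
  proof -
    have "\<exists>F. \<forall>x::real. (0::ereal) < x \<longrightarrow> x < \<infinity> \<longrightarrow> (F has_vector_derivative ln x / (1 + x)) (at x)"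
      by (rule einterval_antiderivative) (auto intro!: continuous_intros)
    then show ?thesis using that by (auto simp: has_real_derivative_iff_has_vector_derivative)
  qed
  \<comment> \<open>The value of \<open>K x + K (1 / x) - (ln x)^2 / 2\<close> at x = 1. This
    expression is constant: the derivatives of the two \<open>K\<close> terms add up to
    \<open>ln x / x\<close>.\<close>
  define C where "C = K 1 + K 1"
  have refl: "K x = (ln x)\<^sup>2 / 2 + C - K (1 / x)" if "x > 0" for x
  proof -
    have "((\<lambda>x. K x + K (1 / x) - (ln x)\<^sup>2 / 2) has_real_derivative 0) (at x within {0<..})"
      if "x > 0" for x
    proof (rule has_field_derivative_at_within)
      have [derivative_intros]: "((\<lambda>x. K (1 / x)) has_real_derivative
          (ln (1 / x) / (1 + 1 / x)) * (- 1 / x\<^sup>2)) (at x)"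
        using that by (intro DERIV_chain2[OF K]) (auto intro!: derivative_eq_intros simp: power2_eq_square)
      show "((\<lambda>x. K x + K (1 / x) - (ln x)\<^sup>2 / 2) has_real_derivative 0) (at x)"
        using that by (auto intro!: derivative_eq_intros K simp: ln_div divide_simps)
          (simp add: power2_eq_square algebra_simps)
    qed
    then have "\<exists>c. \<forall>x\<in>{0<..}. K x + K (1 / x) - (ln x)\<^sup>2 / 2 = c"
      by (intro has_field_derivative_zero_constant) auto
    then obtain c where c: "\<And>x. x > 0 \<Longrightarrow> K x + K (1 / x) - (ln x)\<^sup>2 / 2 = c" by auto
    from c[of 1] c[OF that] show ?thesis by (simp add: C_def)
  qed
  \<comment> \<open>Differentiating \<open>K (x / a)\<close> gives
    \<open>(ln x - ln a) / (x + a)\<close>; the last term of \<open>F\<close> cancels the stray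
    \<open>ln a / (x + a)\<close>.\<close>
  define F where "F = (\<lambda>x. K x - K (x / a) - ln a * ln (1 + x / a))"
  have "((\<lambda>x. ln x * (1 / (x + 1) - 1 / (x + a))) has_integral (ln a)\<^sup>2 / 2 - 0) {0<..}"
  proof (rule FTC_Ioi)
    fix x :: real assume x: "x > 0"
    have [derivative_intros]: "((\<lambda>x. K (x / a)) has_real_derivative
        (ln (x / a) / (1 + x / a)) * (1 / a)) (at x)"
      using x a by (intro DERIV_chain2[OF K]) (auto intro!: derivative_eq_intros)
    have nz: "x + a \<noteq> 0" "1 + x / a > 0" "1 + x / a = (x + a) / a"
      using x a by (auto simp: field_simps add_pos_pos)
    have "(F has_real_derivative
        ln x / (1 + x) - (ln (x / a) / (1 + x / a)) * (1 / a) - ln a * (1 / a / (1 + x / a))) (at x)"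
      unfolding F_def using nz x a by (auto intro!: derivative_eq_intros K)
    moreover have "ln x / (1 + x) - (ln (x / a) / (1 + x / a)) * (1 / a) - ln a * (1 / a / (1 + x / a))
        = ln x * (1 / (x + 1) - 1 / (x + a))"
    proof -
      have "ln (x / a) = ln x - ln a" using x a by (simp add: ln_div)
      then show ?thesis using nz x a by (simp add: divide_simps) (simp add: algebra_simps)
    qed
    ultimately show "(F has_real_derivative ln x * (1 / (x + 1) - 1 / (x + a))) (at x)" by simp
  next
    show cont: "continuous_on {0<..} (\<lambda>x. ln x * (1 / (x + 1) - 1 / (x + a)))"
      using a by (intro continuous_intros) (auto simp: add_eq_0_iff)
    show "(\<lambda>x. ln x * (1 / (x + 1) - 1 / (x + a))) absolutely_integrable_on {0<..}"
    proof (rule ln_dominated_absolutely_integrable[OF cont])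
      fix x :: real assume x: "x > 0"
      \<comment> \<open>Both \<open>x + 1\<close> and \<open>x + a\<close> are at least
        \<open>x + m\<close>, so the difference of reciprocals is bounded by a multiple of
        \<open>1 / (x + m)^2\<close>.\<close>
      define m where "m = min 1 a"
      have m: "m > 0" "m \<le> 1" "m \<le> a" using a by (auto simp: m_def)
      have "1 / (x + 1) - 1 / (x + a) = (a - 1) / ((x + 1) * (x + a))"
        using x a by (simp add: divide_simps) 
      then have "\<bar>1 / (x + 1) - 1 / (x + a)\<bar> = \<bar>a - 1\<bar> / ((x + 1) * (x + a))"
        using x a by (simp add: abs_mult)
      also have "\<dots> \<le> \<bar>a - 1\<bar> / ((x + m) * (x + m))"
        using x m a by (intro divide_left_mono mult_mono mult_pos_pos) auto
      finally have "\<bar>ln x\<bar> * \<bar>1 / (x + 1) - 1 / (x + a)\<bar> \<le> \<bar>ln x\<bar> * (\<bar>a - 1\<bar> / ((x + m) * (x + m)))"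
        by (intro mult_left_mono) auto
      then show "\<bar>ln x * (1 / (x + 1) - 1 / (x + a))\<bar> \<le> \<bar>a - 1\<bar> * \<bar>ln x\<bar> / (x + min 1 a)\<^sup>2"
        by (simp add: abs_mult power2_eq_square mult.commute m_def)
    qed (use a in auto)
    have "((\<lambda>x. ln a * ln (1 + x / a)) \<longlongrightarrow> ln a * ln (1 + 0 / a)) (at_right 0)"
      using a by (intro tendsto_intros) auto
    then show "(F \<longlongrightarrow> 0) (at_right 0)"
      unfolding F_def using tendsto_diff[OF scaled_increment_tendsto_0[OF K, of "1 / a"]] a by fastforce
    \<comment> \<open>Reflection turns the increment of \<open>K\<close> at infinity into one near
      0, which vanishes in the limit, while \<open>C\<close> cancels. The logarithmic rest is
      \<open>ln a * (ln x - ln (1 + x / a)) - (ln a)^2 / 2\<close>, and its bracket tends to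
      \<open>ln a\<close>.\<close>
    have "((\<lambda>x. K (1 / x) - K (a * (1 / x))) \<longlongrightarrow> 0) at_top"
      by (rule filterlim_compose[OF scaled_increment_tendsto_0[OF K a]]) (auto, real_asymp)
    moreover have "((\<lambda>x. ((ln x)\<^sup>2 - (ln x - ln a)\<^sup>2) / 2 - ln a * ln (1 + x / a)) \<longlongrightarrow> (ln a)\<^sup>2 / 2) at_top"
      using a by (real_asymp simp: algebra_simps power2_eq_square ln_inverse)
    ultimately have "((\<lambda>x. ((ln x)\<^sup>2 - (ln x - ln a)\<^sup>2) / 2 - ln a * ln (1 + x / a)
        - (K (1 / x) - K (a * (1 / x)))) \<longlongrightarrow> (ln a)\<^sup>2 / 2 - 0) at_top"
      by (intro tendsto_diff)
    moreover have "\<forall>\<^sub>F x in at_top. ((ln x)\<^sup>2 - (ln x - ln a)\<^sup>2) / 2 - ln a * ln (1 + x / a)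
        - (K (1 / x) - K (a * (1 / x))) = F x"
      using eventually_gt_at_top[of 0]
    proof eventually_elim
      case (elim x)
      have "x / a > 0" using elim a by simp
      from refl[OF this] refl[OF elim] show ?case
        unfolding F_def using elim a by (simp add: ln_div field_simps)
    qed
    ultimately show "(F \<longlongrightarrow> (ln a)\<^sup>2 / 2) at_top"
      by (simp add: filterlim_cong)
  qed
  then show ?thesis by simp
qed

subsection \<open>Recurrences\<close>

lemma has_integral_ln_over_shift_square:
  fixes a :: real
  assumes a: "a > 0"
  shows "((\<lambda>x. ln x / (x + a)\<^sup>2) has_integral ln a / a) {0<..}"
proof -
  \<comment> \<open>Integration by parts with \<open>x / (a * (x + a))\<close> as the antiderivative
    of \<open>1 / (x + a)^2\<close>. It vanishes at 0 and so absorbs the singularity of the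
    logarithm there.\<close>
  define F where "F = (\<lambda>x. (x * ln x / (x + a) - ln (x + a)) / a)"
  have cont: "continuous_on {0<..} (\<lambda>x. ln x / (x + a)\<^sup>2)"
    using a by (intro continuous_intros) auto
  have "((\<lambda>x. ln x / (x + a)\<^sup>2) has_integral 0 - (- ln a / a)) {0<..}"
  proof (rule FTC_Ioi)
    fix x :: real assume x: "x > 0"
    have "x + a > 0" using x a by simp
    then show "(F has_real_derivative ln x / (x + a)\<^sup>2) (at x)"
      unfolding F_def using x a
      by (auto intro!: derivative_eq_intros)
         (simp add: divide_simps power2_eq_square, simp add: algebra_simps)
  next
    show "(\<lambda>x. ln x / (x + a)\<^sup>2) absolutely_integrable_on {0<..}"
      by (rule ln_dominated_absolutely_integrable[OF cont, of 1 a]) (use a in auto)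
    have "((\<lambda>x::real. x * ln x) \<longlongrightarrow> 0) (at_right 0)" by real_asymp
    then have "(F \<longlongrightarrow> (0 / (0 + a) - ln (0 + a)) / a) (at_right 0)"
      unfolding F_def using a by (intro tendsto_intros) auto
    then show "(F \<longlongrightarrow> - ln a / a) (at_right 0)" by simp
    show "(F \<longlongrightarrow> 0) at_top"
      unfolding F_def using a by real_asymp
  qed (use cont in auto)
  then show ?thesis by simp
qed

lemma absolutely_integrable_power_ln_over_shift:
  fixes a :: real
  assumes a: "a > 0"
  shows "(\<lambda>x. x ^ m * ln x / (x + a) ^ (m + 2)) absolutely_integrable_on {0<..}"
proof (rule ln_dominated_absolutely_integrable[of _ 1 a])
  show "continuous_on {0<..} (\<lambda>x. x ^ m * ln x / (x + a) ^ (m + 2))"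
    using a by (intro continuous_intros) auto
  fix x :: real assume x: "x > 0"
  have "(x / (x + a)) ^ m \<le> 1"
    using x a by (intro power_le_one) auto
  then have "(x / (x + a)) ^ m * (\<bar>ln x\<bar> / (x + a)\<^sup>2) \<le> 1 * (\<bar>ln x\<bar> / (x + a)\<^sup>2)"
    by (intro mult_right_mono) auto
  moreover have "\<bar>x ^ m * ln x / (x + a) ^ (m + 2)\<bar> = (x / (x + a)) ^ m * (\<bar>ln x\<bar> / (x + a)\<^sup>2)"
    using x a by (simp add: abs_mult power_divide power_add power2_eq_square)
  ultimately show "\<bar>x ^ m * ln x / (x + a) ^ (m + 2)\<bar> \<le> 1 * \<bar>ln x\<bar> / (x + a)\<^sup>2" by simp
qed (use a in auto)

lemma absolutely_integrable_ln_over_shift: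
  fixes a :: real
  assumes a: "a > 0"
  shows "(\<lambda>x. ln x / (x + a) ^ (m + 2)) absolutely_integrable_on {0<..}"
proof (rule ln_dominated_absolutely_integrable[of _ "(1 / a) ^ m" a])
  show "continuous_on {0<..} (\<lambda>x. ln x / (x + a) ^ (m + 2))"
    using a by (intro continuous_intros) auto
  fix x :: real assume x: "x > 0"
  have "(1 / (x + a)) ^ m \<le> (1 / a) ^ m"
    using x a by (intro power_mono) (auto simp: divide_simps)
  then have "(1 / (x + a)) ^ m * (\<bar>ln x\<bar> / (x + a)\<^sup>2) \<le> (1 / a) ^ m * (\<bar>ln x\<bar> / (x + a)\<^sup>2)"
    by (intro mult_right_mono) auto
  moreover have "\<bar>ln x / (x + a) ^ (m + 2)\<bar> = (1 / (x + a)) ^ m * (\<bar>ln x\<bar> / (x + a)\<^sup>2)"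
    using x a by (simp add: power_divide power_add power2_eq_square)
  ultimately show "\<bar>ln x / (x + a) ^ (m + 2)\<bar> \<le> (1 / a) ^ m * \<bar>ln x\<bar> / (x + a)\<^sup>2" by simp
qed (use a in auto)

text \<open>With u = x / (x + a) the integrand is u^m u' / a, and u runs from 0 to 1. This is the
  inhomogeneous term in the recurrence for the integrals with \<open>x ^ m * ln x\<close>.\<close>

lemma power_over_shift_integral:
  fixes a :: real
  assumes a: "a > 0"
  shows "(\<lambda>x. x ^ m / (x + a) ^ (m + 2)) absolutely_integrable_on {0<..}" (is ?I)
    and "((\<lambda>x. x ^ m / (x + a) ^ (m + 2)) has_integral 1 / (real (m + 1) * a)) {0<..}" (is ?V)
proof -
  define F where "F = (\<lambda>x. (x / (x + a)) ^ (m + 1) / (real (m + 1) * a))"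
  have D: "(F has_real_derivative x ^ m / (x + a) ^ (m + 2)) (at x)" if x: "x > 0" for x
  proof -
    have nz: "x + a \<noteq> 0" using x a by simp
    have "((\<lambda>x. x / (x + a)) has_real_derivative a / (x + a)\<^sup>2) (at x)"
      using nz by (auto intro!: derivative_eq_intros simp: power2_eq_square)
    from DERIV_power[OF this, of "m + 1"]
    have "((\<lambda>x. (x / (x + a)) ^ (m + 1)) has_real_derivative
        real (m + 1) * (a / (x + a)\<^sup>2 * (x / (x + a)) ^ m)) (at x)" by simp
    from DERIV_cdivide[OF this, of "real (m + 1) * a"]
    have "(F has_real_derivative
        real (m + 1) * (a / (x + a)\<^sup>2 * (x / (x + a)) ^ m) / (real (m + 1) * a)) (at x)"
      unfolding F_def .
    moreover have "real (m + 1) * (a / (x + a)\<^sup>2 * (x / (x + a)) ^ m) / (real (m + 1) * a)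
        = x ^ m / (x + a) ^ (m + 2)"
      using a nz by (simp add: power_divide power_add power2_eq_square divide_simps)
    ultimately show ?thesis by simp
  qed
  have cont: "continuous_on {0<..} (\<lambda>x. x ^ m / (x + a) ^ (m + 2))"
    using a by (intro continuous_intros) auto
  have "(F \<longlongrightarrow> (0 / (0 + a)) ^ (m + 1) / (real (m + 1) * a)) (at_right 0)"
    unfolding F_def using a by (intro tendsto_intros) auto
  then have lim0: "(F \<longlongrightarrow> 0) (at_right 0)" by simp
  have "((\<lambda>x. x / (x + a)) \<longlongrightarrow> 1) at_top" by real_asymp
  then have "(F \<longlongrightarrow> 1 ^ (m + 1) / (real (m + 1) * a)) at_top"
    unfolding F_def using a by (intro tendsto_intros) auto
  then have lim1: "(F \<longlongrightarrow> 1 / (real (m + 1) * a)) at_top" by simp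
  show ?I by (rule FTC_Ioi_nonneg(1)[OF D cont _ lim0 lim1]) (use a in auto)
  have "((\<lambda>x. x ^ m / (x + a) ^ (m + 2)) has_integral 1 / (real (m + 1) * a) - 0) {0<..}"
    by (rule FTC_Ioi_nonneg(2)[OF D cont _ lim0 lim1]) (use a in auto)
  then show ?V by simp
qed

lemma inverse_power_shift_integral:
  fixes a :: real
  assumes a: "a > 0"
  shows "(\<lambda>x. 1 / (x + a) ^ (m + 2)) absolutely_integrable_on {0<..}" (is ?I)
    and "((\<lambda>x. 1 / (x + a) ^ (m + 2)) has_integral 1 / (real (m + 1) * a ^ (m + 1))) {0<..}" (is ?V)
proof -
  define F where "F = (\<lambda>x. - ((1 / (x + a)) ^ (m + 1) / real (m + 1)))"
  have D: "(F has_real_derivative 1 / (x + a) ^ (m + 2)) (at x)" if x: "x > 0" for x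
  proof -
    have nz: "x + a \<noteq> 0" using x a by simp
    have "((\<lambda>x. 1 / (x + a)) has_real_derivative - 1 / (x + a)\<^sup>2) (at x)"
      using nz by (auto intro!: derivative_eq_intros simp: power2_eq_square)
    from DERIV_power[OF this, of "m + 1"]
    have "((\<lambda>x. (1 / (x + a)) ^ (m + 1)) has_real_derivative
        real (m + 1) * (- 1 / (x + a)\<^sup>2 * (1 / (x + a)) ^ m)) (at x)" by simp
    from DERIV_minus[OF DERIV_cdivide[OF this, of "real (m + 1)"]]
    have "(F has_real_derivative
        - (real (m + 1) * (- 1 / (x + a)\<^sup>2 * (1 / (x + a)) ^ m) / real (m + 1))) (at x)"
      unfolding F_def .
    moreover have "- (real (m + 1) * (- 1 / (x + a)\<^sup>2 * (1 / (x + a)) ^ m) / real (m + 1))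
        = 1 / (x + a) ^ (m + 2)"
      using a nz by (simp add: power_divide power_add power2_eq_square divide_simps)
    ultimately show ?thesis by simp
  qed
  have cont: "continuous_on {0<..} (\<lambda>x. 1 / (x + a) ^ (m + 2))"
    using a by (intro continuous_intros) auto
  have "(F \<longlongrightarrow> - ((1 / (0 + a)) ^ (m + 1) / real (m + 1))) (at_right 0)"
    unfolding F_def using a by (intro tendsto_intros) auto
  then have lim0: "(F \<longlongrightarrow> - (1 / (real (m + 1) * a ^ (m + 1)))) (at_right 0)"
    by (simp add: power_divide mult_ac)
  have "((\<lambda>x. 1 / (x + a)) \<longlongrightarrow> 0) at_top" by real_asymp
  then have "(F \<longlongrightarrow> - (0 ^ (m + 1) / real (m + 1))) at_top"
    unfolding F_def by (intro tendsto_intros) auto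
  then have lim1: "(F \<longlongrightarrow> 0) at_top" by simp
  show ?I by (rule FTC_Ioi_nonneg(1)[OF D cont _ lim0 lim1]) (use a in auto)
  have "((\<lambda>x. 1 / (x + a) ^ (m + 2)) has_integral 0 - - (1 / (real (m + 1) * a ^ (m + 1)))) {0<..}"
    by (rule FTC_Ioi_nonneg(2)[OF D cont _ lim0 lim1]) (use a in auto)
  then show ?V by simp
qed

text \<open>Write I_m for the integral. Integrating the derivative of - x^(m+1) ln x / (x +
  a)^(m+2), whose boundary values vanish, gives (m+2) I_(m+1) = (m+1) I_m + 1 / ((m+1) a). Thus
  (m+1) a I_m grows by 1/(m+1) at each step, starting from ln a.\<close>

lemma has_integral_power_ln_over_shift:
  fixes a :: real
  assumes a: "a > 0"
  shows "((\<lambda>x. x ^ m * ln x / (x + a) ^ (m + 2)) has_integral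
    (ln a + harm m) / (real (m + 1) * a)) {0<..}"
proof (induction m)
  case 0
  then show ?case using has_integral_ln_over_shift_square[OF a] by (simp add: harm_def power2_eq_square)
next
  case (Suc m)
  define f where "f = (\<lambda>m x. x ^ m * ln x / (x + a) ^ (m + 2))"
  define h where "h = (\<lambda>x. x ^ m / (x + a) ^ (m + 2))"
  \<comment> \<open>Factored as powers of \<open>x / (x + a)\<close>, which converge at both ends,
    times \<open>x * ln x / (x + a)^2\<close>, which tends to 0 at both ends.\<close>
  define G where "G = (\<lambda>x. - ((x / (x + a)) ^ m * (x * ln x / (x + a)\<^sup>2)))"
  define r where "r = (\<lambda>x. real (m + 2) * f (Suc m) x - real (m + 1) * f m x - h x)"
  have fi: "f n absolutely_integrable_on {0<..}" for n
    unfolding f_def by (rule absolutely_integrable_power_ln_over_shift[OF a])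
  have hi: "h absolutely_integrable_on {0<..}"
    and hv: "(h has_integral 1 / (real (m + 1) * a)) {0<..}"
    unfolding h_def by (rule power_over_shift_integral[OF a])+
  have "(r has_integral 0 - 0) {0<..}"
  proof (rule FTC_Ioi)
    fix x :: real assume x: "x > 0"
    have nz: "x + a \<noteq> 0" using x a by simp
    have "((\<lambda>x. - (x ^ Suc m * ln x / (x + a) ^ Suc (Suc m))) has_real_derivative r x) (at x)"
      using x nz unfolding r_def f_def h_def
      by (auto intro!: derivative_eq_intros simp del: power_Suc)
         (simp add: divide_simps power2_eq_square, simp add: algebra_simps)
    moreover have "G = (\<lambda>x. - (x ^ Suc m * ln x / (x + a) ^ Suc (Suc m)))"
      by (simp add: G_def power_divide power2_eq_square mult_ac)
    ultimately show "(G has_real_derivative r x) (at x)" by simp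
  next
    show "continuous_on {0<..} r"
      unfolding r_def f_def h_def using a by (intro continuous_intros) auto
    show "r absolutely_integrable_on {0<..}"
      unfolding r_def using fi hi by (intro set_integral_diff set_integrable_mult_right) auto
    have "((\<lambda>x. x * ln x / (x + a)\<^sup>2) \<longlongrightarrow> 0) (at_right 0)" using a by real_asymp
    then have "(G \<longlongrightarrow> - ((0 / (0 + a)) ^ m * 0)) (at_right 0)"
      unfolding G_def using a by (intro tendsto_intros) auto
    then show "(G \<longlongrightarrow> 0) (at_right 0)" by simp
    have "((\<lambda>x. x * ln x / (x + a)\<^sup>2) \<longlongrightarrow> 0) at_top"
      "((\<lambda>x. x / (x + a)) \<longlongrightarrow> 1) at_top" by real_asymp+
    then have "(G \<longlongrightarrow> - (1 ^ m * 0)) at_top"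
      unfolding G_def by (intro tendsto_intros) auto
    then show "(G \<longlongrightarrow> 0) at_top" by simp
  qed
  then have r: "(r has_integral 0) {0<..}" by simp
  have IH: "(f m has_integral (ln a + harm m) / (real (m + 1) * a)) {0<..}"
    using Suc.IH by (simp add: f_def)
  have "((\<lambda>x. 1 / real (m + 2) * (r x + real (m + 1) * f m x + h x)) has_integral
      1 / real (m + 2) * (0 + real (m + 1) * ((ln a + harm m) / (real (m + 1) * a))
        + 1 / (real (m + 1) * a))) {0<..}"
    by (intro has_integral_add has_integral_mult_right r IH hv)
  moreover have "(\<lambda>x. 1 / real (m + 2) * (r x + real (m + 1) * f m x + h x)) = f (Suc m)"
    by (rule ext) (simp add: r_def field_simps)
  moreover have "1 / real (m + 2) * (0 + real (m + 1) * ((ln a + harm m) / (real (m + 1) * a))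
        + 1 / (real (m + 1) * a))
      = (ln a + harm (Suc m)) / (real (Suc m + 1) * a)"
    using a by (simp add: harm_Suc divide_simps) (simp add: algebra_simps)
  ultimately show ?case by (simp add: f_def)
qed

text \<open>The same scheme with x ln x / (x + a)^(m+2); writing x = (x + a) - a in its derivative
  relates consecutive integrals J_m. Now (m+1) a^(m+1) J_m drops by 1/(m+1) at each step, hence the
  minus sign before the harmonic number.\<close>

lemma has_integral_ln_over_shift:
  fixes a :: real
  assumes a: "a > 0"
  shows "((\<lambda>x. ln x / (x + a) ^ (m + 2)) has_integral
    (ln a - harm m) / (real (m + 1) * a ^ (m + 1))) {0<..}"
proof (induction m)
  case 0
  then show ?case using has_integral_ln_over_shift_square[OF a] by (simp add: harm_def power2_eq_square)
next
  case (Suc m)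
  define f where "f = (\<lambda>m x. ln x / (x + a) ^ (m + 2))"
  define h where "h = (\<lambda>x. 1 / (x + a) ^ (m + 2))"
  define G where "G = (\<lambda>x. (1 / (x + a)) ^ m * (x * ln x / (x + a)\<^sup>2))"
  define r where "r = (\<lambda>x. real (m + 2) * a * f (Suc m) x - real (m + 1) * f m x + h x)"
  have fi: "f n absolutely_integrable_on {0<..}" for n
    unfolding f_def by (rule absolutely_integrable_ln_over_shift[OF a])
  have hi: "h absolutely_integrable_on {0<..}"
    and hv: "(h has_integral 1 / (real (m + 1) * a ^ (m + 1))) {0<..}"
    unfolding h_def by (rule inverse_power_shift_integral[OF a])+
  have "(r has_integral 0 - 0) {0<..}"
  proof (rule FTC_Ioi)
    fix x :: real assume x: "x > 0"
    have nz: "x + a \<noteq> 0" using x a by simp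
    have "((\<lambda>x. x * ln x / (x + a) ^ Suc (Suc m)) has_real_derivative r x) (at x)"
      using x nz unfolding r_def f_def h_def
      by (auto intro!: derivative_eq_intros simp del: power_Suc)
         (simp add: divide_simps power2_eq_square, simp add: algebra_simps)
    moreover have "G = (\<lambda>x. x * ln x / (x + a) ^ Suc (Suc m))"
      by (simp add: G_def power_divide power2_eq_square mult_ac)
    ultimately show "(G has_real_derivative r x) (at x)" by simp
  next
    show "continuous_on {0<..} r"
      unfolding r_def f_def h_def using a by (intro continuous_intros) auto
    show "r absolutely_integrable_on {0<..}"
      unfolding r_def using fi hi by (intro set_integral_add set_integral_diff set_integrable_mult_right) auto
    have "((\<lambda>x. x * ln x / (x + a)\<^sup>2) \<longlongrightarrow> 0) (at_right 0)" using a by real_asymp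
    then have "(G \<longlongrightarrow> (1 / (0 + a)) ^ m * 0) (at_right 0)"
      unfolding G_def using a by (intro tendsto_intros) auto
    then show "(G \<longlongrightarrow> 0) (at_right 0)" by simp
    have "((\<lambda>x. x * ln x / (x + a)\<^sup>2) \<longlongrightarrow> 0) at_top"
      "((\<lambda>x. 1 / (x + a)) \<longlongrightarrow> 0) at_top" by real_asymp+
    then have "(G \<longlongrightarrow> 0 ^ m * 0) at_top"
      unfolding G_def by (intro tendsto_intros) auto
    then show "(G \<longlongrightarrow> 0) at_top" by simp
  qed
  then have r: "(r has_integral 0) {0<..}" by simp
  have IH: "(f m has_integral (ln a - harm m) / (real (m + 1) * a ^ (m + 1))) {0<..}"
    using Suc.IH by (simp add: f_def)
  have "((\<lambda>x. 1 / (real (m + 2) * a) * (r x + real (m + 1) * f m x - h x)) has_integral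
      1 / (real (m + 2) * a) * (0 + real (m + 1) * ((ln a - harm m) / (real (m + 1) * a ^ (m + 1)))
        - 1 / (real (m + 1) * a ^ (m + 1)))) {0<..}"
    by (intro has_integral_add has_integral_diff has_integral_mult_right r IH hv)
  moreover have "(\<lambda>x. 1 / (real (m + 2) * a) * (r x + real (m + 1) * f m x - h x)) = f (Suc m)"
    using a by (intro ext) (simp add: r_def divide_simps)
  moreover have "1 / (real (m + 2) * a) * (0 + real (m + 1) * ((ln a - harm m) / (real (m + 1) * a ^ (m + 1)))
        - 1 / (real (m + 1) * a ^ (m + 1)))
      = (ln a - harm (Suc m)) / (real (Suc m + 1) * a ^ (Suc m + 1))"
    using a by (simp add: harm_Suc divide_simps) (simp add: algebra_simps)
  ultimately show ?case by (simp add: f_def)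
qed

section \<open>The integrals with the factor x - 1 in the denominator\<close>

lemma has_integral_ln_over_quadratic:
  fixes a :: real
  assumes a: "a > 0"
  shows "((\<lambda>x. ln x / ((x - 1) * (x + a))) has_integral (pi\<^sup>2 + (ln a)\<^sup>2) / 2 / (a + 1)) {0<..}"
proof -
  \<comment> \<open>Partial fractions give 1/(x - 1) - 1/(x + a), but with the factor ln x neither
    term converges at infinity. Inserting 1/(x + 1) with both signs splits the integrand into two
    convergent pieces.\<close>
  have "((\<lambda>x. 1 / (a + 1) * (2 * (ln x / (x\<^sup>2 - 1)) + ln x * (1 / (x + 1) - 1 / (x + a)))) has_integral
      1 / (a + 1) * (2 * (pi\<^sup>2 / 4) + (ln a)\<^sup>2 / 2)) {0<..}"
    by (intro has_integral_add has_integral_mult_right has_integral_ln_over_square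
        has_integral_ln_shift_difference a)
  then have "((\<lambda>x. ln x / ((x - 1) * (x + a))) has_integral
      1 / (a + 1) * (2 * (pi\<^sup>2 / 4) + (ln a)\<^sup>2 / 2)) {0<..}"
  proof (rule has_integral_eq[rotated])
    fix x :: real assume "x \<in> {0<..}"
    then have nz: "x > 0" "x + 1 \<noteq> 0" "x + a \<noteq> 0" "a + 1 \<noteq> 0" using a by auto
    show "1 / (a + 1) * (2 * (ln x / (x\<^sup>2 - 1)) + ln x * (1 / (x + 1) - 1 / (x + a)))
        = ln x / ((x - 1) * (x + a))"
    \<comment> \<open>At x = 1 both sides are 0 because \<open>ln 1 = 0\<close>, so the identity
      holds pointwise there too; the recurrences below treat this point in the same way.\<close>
    proof (cases "x = 1")
      case False
      have "x\<^sup>2 - 1 = (x - 1) * (x + 1)" by (simp add: power2_eq_square algebra_simps)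
      then show ?thesis using False nz by (simp add: divide_simps) (simp add: algebra_simps)
    qed simp
  qed
  then show ?thesis by (simp add: field_simps)
qed

text \<open>Dividing (x + a) - (x - 1) = a + 1 by (x - 1) (x + a)^(k+2) expresses the case k + 1
  through the case k and an integral without the factor x - 1.\<close>

lemma has_integral_ln_over_pole_shift:
  fixes a :: real
  assumes a: "a > 0"
  shows "((\<lambda>x. ln x / ((x - 1) * (x + a) ^ (k + 1))) has_integral
      ((pi\<^sup>2 + (ln a)\<^sup>2) / 2
        + (\<Sum>j<k. (1 + 1 / a) ^ (j + 1) / real (j + 1) * (harm j - ln a)))
      / (a + 1) ^ (k + 1)) {0<..}"
  (is "(?f k has_integral ?v k) _")
proof (induction k)
  case 0 show ?case using has_integral_ln_over_quadratic[OF a] by simp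
next
  case (Suc k)
  have "((\<lambda>x. 1 / (a + 1) * (?f k x - ln x / (x + a) ^ (k + 2))) has_integral
      1 / (a + 1) * (?v k - (ln a - harm k) / (real (k + 1) * a ^ (k + 1)))) {0<..}"
    by (intro has_integral_mult_right has_integral_diff Suc.IH has_integral_ln_over_shift a)
  moreover have "1 / (a + 1) * (?v k - (ln a - harm k) / (real (k + 1) * a ^ (k + 1))) = ?v (Suc k)"
  proof -
    \<comment> \<open>Pulling \<open>1 / (a + 1) ^ (k + 2)\<close> out of the new term leaves
      \<open>((a + 1) / a) ^ (k + 1)\<close>, which is the weight in the sum.\<close>
    have "(1 + 1 / a) ^ (k + 1) = (a + 1) ^ (k + 1) / a ^ (k + 1)"
      using a by (simp only: power_divide[symmetric]) (simp add: add_divide_distrib)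
    then show ?thesis using a by (simp add: divide_simps) (simp add: algebra_simps)
  qed
  ultimately have "((\<lambda>x. 1 / (a + 1) * (?f k x - ln x / (x + a) ^ (k + 2)))
      has_integral ?v (Suc k)) {0<..}"
    by simp
  then show ?case
  proof (rule has_integral_eq[rotated])
    fix x :: real assume "x \<in> {0<..}"
    then have nz: "x > 0" "x + a \<noteq> 0" "a + 1 \<noteq> 0" using a by auto
    show "1 / (a + 1) * (?f k x - ln x / (x + a) ^ (k + 2)) = ?f (Suc k) x"
      using nz by (cases "x = 1"; simp add: divide_simps; simp add: algebra_simps)
  qed
qed

text \<open>Here the identity is (a + 1) x = (x + a) + a (x - 1), whose left side supplies the extra
  power of x. The factor \<open>a ^ (j + 1)\<close> in the summand undoes the denominator of the
  weight.\<close>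

lemma has_integral_power_ln_over_pole_shift:
  fixes a :: real
  assumes a: "a > 0"
  shows "((\<lambda>x. x ^ k * ln x / ((x - 1) * (x + a) ^ (k + 1))) has_integral
      ((pi\<^sup>2 + (ln a)\<^sup>2) / 2
        + (\<Sum>j<k. (1 + 1 / a) ^ (j + 1) / real (j + 1) * (a ^ (j + 1) * (harm j + ln a))))
      / (a + 1) ^ (k + 1)) {0<..}"
  (is "(?f k has_integral ?v k) _")
proof (induction k)
  case 0 show ?case using has_integral_ln_over_quadratic[OF a] by simp
next
  case (Suc k)
  have "((\<lambda>x. 1 / (a + 1) * (?f k x + a * (x ^ k * ln x / (x + a) ^ (k + 2)))) has_integral
      1 / (a + 1) * (?v k + a * ((ln a + harm k) / (real (k + 1) * a)))) {0<..}"
    by (intro has_integral_mult_right has_integral_add Suc.IH has_integral_power_ln_over_shift a)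
  moreover have "1 / (a + 1) * (?v k + a * ((ln a + harm k) / (real (k + 1) * a))) = ?v (Suc k)"
  proof -
    have "(1 + 1 / a) ^ (k + 1) = (a + 1) ^ (k + 1) / a ^ (k + 1)"
      using a by (simp only: power_divide[symmetric]) (simp add: add_divide_distrib)
    then show ?thesis using a by (simp add: divide_simps) (simp add: algebra_simps)
  qed
  ultimately have "((\<lambda>x. 1 / (a + 1) * (?f k x + a * (x ^ k * ln x / (x + a) ^ (k + 2))))
      has_integral ?v (Suc k)) {0<..}"
    by simp
  then show ?case
  proof (rule has_integral_eq[rotated])
    fix x :: real assume "x \<in> {0<..}"
    then have nz: "x > 0" "x + a \<noteq> 0" "a + 1 \<noteq> 0" using a by auto
    show "1 / (a + 1) * (?f k x + a * (x ^ k * ln x / (x + a) ^ (k + 2))) = ?f (Suc k) x"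
      using nz by (cases "x = 1"; simp add: divide_simps; simp add: algebra_simps)
  qed
qed

section \<open>Difference and sum of the two evaluations\<close>

theorem theorem14:
  fixes k :: nat and a :: real
  assumes "a > 0"
  shows "((\<lambda>x::real. (x ^ k - 1) * ln x / ((x - 1) * (x + a) ^ (k + 1))) has_integral
            1 / (a + 1) ^ (k + 1) *
            (\<Sum>j<k. (1 + 1 / a) ^ (j + 1) / real (j + 1) *
                   ((a ^ (j + 1) - 1) * harm j + (a ^ (j + 1) + 1) * ln a))) {0<..}
       \<and> ((\<lambda>x::real. (x ^ k + 1) * ln x / ((x - 1) * (x + a) ^ (k + 1))) has_integral
            (pi\<^sup>2 + (ln a)\<^sup>2) / (a + 1) ^ (k + 1) +
            1 / (a + 1) ^ (k + 1) *
            (\<Sum>j<k. (1 + 1 / a) ^ (j + 1) / real (j + 1) *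
                   ((a ^ (j + 1) + 1) * harm j + (a ^ (j + 1) - 1) * ln a))) {0<..}"
proof (rule conjI)
  let ?w = "\<lambda>j. (1 + 1 / a) ^ (j + 1) / real (j + 1)"
  let ?S = "\<Sum>j<k. ?w j * (a ^ (j + 1) * (harm j + ln a))"
  let ?T = "\<Sum>j<k. ?w j * (harm j - ln a)"
  \<comment> \<open>The common initial value, up to the factor \<open>1 / (a + 1) ^ (k + 1)\<close>:
    it cancels in the difference and doubles in the sum, so only the second identity contains
    pi.\<close>
  let ?P = "(pi\<^sup>2 + (ln a)\<^sup>2) / 2"
  note A = has_integral_power_ln_over_pole_shift[OF assms, of k]
    and B = has_integral_ln_over_pole_shift[OF assms, of k]
  have D: "(\<Sum>j<k. ?w j * ((a ^ (j + 1) - 1) * harm j + (a ^ (j + 1) + 1) * ln a)) = ?S - ?T"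
    unfolding sum_subtractf[symmetric] by (intro sum.cong refl) (simp only: algebra_simps)
  have E: "(\<Sum>j<k. ?w j * ((a ^ (j + 1) + 1) * harm j + (a ^ (j + 1) - 1) * ln a)) = ?S + ?T"
    unfolding sum.distrib[symmetric] by (intro sum.cong refl) (simp only: algebra_simps)
  have "1 / (a + 1) ^ (k + 1) * (?S - ?T) = (?P + ?S) / (a + 1) ^ (k + 1) - (?P + ?T) / (a + 1) ^ (k + 1)"
    by (simp only: diff_divide_distrib[symmetric]) simp
  with has_integral_diff[OF A B] D
  show "((\<lambda>x::real. (x ^ k - 1) * ln x / ((x - 1) * (x + a) ^ (k + 1))) has_integral
            1 / (a + 1) ^ (k + 1) *
            (\<Sum>j<k. ?w j * ((a ^ (j + 1) - 1) * harm j + (a ^ (j + 1) + 1) * ln a))) {0<..}"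
    by (simp only: diff_divide_distrib[symmetric] left_diff_distrib mult_1)
  have "(pi\<^sup>2 + (ln a)\<^sup>2) / (a + 1) ^ (k + 1) + 1 / (a + 1) ^ (k + 1) * (?S + ?T)
      = (?P + ?S) / (a + 1) ^ (k + 1) + (?P + ?T) / (a + 1) ^ (k + 1)"
    by (simp only: add_divide_distrib[symmetric]) (simp add: add_divide_distrib)
  with has_integral_add[OF A B] E
  show "((\<lambda>x::real. (x ^ k + 1) * ln x / ((x - 1) * (x + a) ^ (k + 1))) has_integral
            (pi\<^sup>2 + (ln a)\<^sup>2) / (a + 1) ^ (k + 1) +
            1 / (a + 1) ^ (k + 1) *
            (\<Sum>j<k. ?w j * ((a ^ (j + 1) + 1) * harm j + (a ^ (j + 1) - 1) * ln a))) {0<..}"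
    by (simp only: add_divide_distrib[symmetric] distrib_right mult_1)
qed

end
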